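(* Let $k\ge l_1\ge\dots\ge l_r\ge0$ be integers, $l_0=k$, $l_{r+1}=0$, and let $m_1,\dots,m_r$ be generic complex numbers. Then there is the equality of differential operators $$D_{\boldsymbol m,\boldsymbol l,k}=(x-1)^{k+1}\,\tilde D_r(\boldsymbol m,\boldsymbol l,k)\,\tilde D_{r-1}(\boldsymbol m,\boldsymbol l,k)\cdots\tilde D_0(\boldsymbol m,\boldsymbol l,k)\,\frac1{x-1}$$ $$=\omega^{-1}(x)\,\frac{d^{\,l_r-l_{r+1}}}{dx^{\,l_r-l_{r+1}}}\,x^{l_r-l_{r+1}-m_r-1}\,\frac{d^{\,l_{r-1}-l_r}}{dx^{\,l_{r-1}-l_r}}\,x^{l_{r-1}-l_r-m_{r-1}-1}\cdots x^{l_1-l_2-m_1-1}\,\frac{d^{\,l_0-l_1}}{dx^{\,l_0-l_1}}\,\frac{x^{l_0-l_1}}{x-1},$$ where $\omega(x)=(x-1)^{-k-1}x^{-\sum_{i=1}^rm_i-r}$.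
   Context: Here $\boldsymbol m=(m_1,\dots,m_r)$, $\boldsymbol l=(l_1,\dots,l_r)$, and products denote compositions of operators (functions act by multiplication). For $i=0,\dots,r$ $$\tilde D_i(\boldsymbol m,\boldsymbol l,k)=x^{\sum_{j=1}^im_j+i}\,\frac{d^{\,l_i-l_{i+1}}}{dx^{\,l_i-l_{i+1}}}\,x^{l_i-l_{i+1}-\sum_{j=1}^im_j-i}.$$ Put $D_i(\boldsymbol l,k)=x(x-1)\frac{d}{dx}-\big(k+\sum_{s=1}^im_s-l_i+l_{i+1}+i\big)(x-1)-k-1$ for $i=0,\dots,r$, and let $\boldsymbol 1_i=(1,\dots,1,0,\dots,0)\in\mathbb Z^r$ with $i$ ones. Then $$D_{\boldsymbol m,\boldsymbol l,k}=D_{j(k)}\Big(\sum_{s=1}^{k-1}\boldsymbol 1_{j(s)},k-1\Big)\cdots D_{j(2)}(\boldsymbol 1_{j(1)},1)\,D_{j(1)}(\boldsymbol 0,0),$$ where $j(1),\dots,j(k)\in\{0,\dots,r\}$ is any sequence with $\sum_{s=1}^k\boldsymbol 1_{j(s)}=\boldsymbol l$; the result does not depend on the order because $D_j(\boldsymbol l+\boldsymbol 1_i,k+1)D_i(\boldsymbol l,k)=D_i(\boldsymbol l+\boldsymbol 1_j,k+1)D_j(\boldsymbol l,k)$. *)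

theory Defs
  imports "HOL-Complex_Analysis.Complex_Analysis"
begin

text \<open>
  Differential operators are represented by their action on functions. Two of them are identified
  on an open set \<open>U\<close> if they agree on every holomorphic function on \<open>U\<close>; this is the same as having
  equal coefficients on \<open>U\<close>, since polynomials already separate the coefficients.
\<close>

type_synonym diff_op = "(complex \<Rightarrow> complex) \<Rightarrow> complex \<Rightarrow> complex"

definition op_eq_on :: "complex set \<Rightarrow> diff_op \<Rightarrow> diff_op \<Rightarrow> bool" where
  "op_eq_on U A B \<longleftrightarrow> (\<forall>f. f holomorphic_on U \<longrightarrow> (\<forall>x\<in>U. A f x = B f x))"

definition mult_op :: "(complex \<Rightarrow> complex) \<Rightarrow> diff_op" where
  "mult_op g = (\<lambda>f x. g x * f x)"

definition ddx :: "nat \<Rightarrow> diff_op" where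
  "ddx n = (\<lambda>f. (deriv ^^ n) f)"

text \<open>\<open>op_prod A n\<close> is \<open>A (n - 1) \<circ> \<dots> \<circ> A 1 \<circ> A 0\<close>; the factor \<open>A 0\<close> acts first.\<close>

primrec op_prod :: "(nat \<Rightarrow> diff_op) \<Rightarrow> nat \<Rightarrow> diff_op" where
  "op_prod A 0 = id"
| "op_prod A (Suc n) = A n \<circ> op_prod A n"

text \<open>The power \<open>x\<^sup>a\<close> for the branch \<open>L\<close> of the logarithm; for integers \<open>a\<close> it is the usual power.\<close>

definition cpow :: "(complex \<Rightarrow> complex) \<Rightarrow> complex \<Rightarrow> complex \<Rightarrow> complex" where
  "cpow L a x = exp (a * L x)"

text \<open>
  A vector \<open>(l\<^sub>1, \<dots>, l\<^sub>r)\<close> is a function of which only the values at \<open>1, \<dots>, r\<close> matter;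
  \<open>lext r l k\<close> extends it by \<open>l\<^sub>0 = k\<close> and \<open>l\<^bsub>r+1\<^esub> = 0\<close>.
\<close>

definition lext :: "nat \<Rightarrow> (nat \<Rightarrow> nat) \<Rightarrow> nat \<Rightarrow> nat \<Rightarrow> nat" where
  "lext r l k i = (if i = 0 then k else if i \<le> r then l i else 0)"

definition one_vec :: "nat \<Rightarrow> nat \<Rightarrow> nat" where
  "one_vec i t = (if 1 \<le> t \<and> t \<le> i then 1 else 0)"

definition D_tilde ::
  "(complex \<Rightarrow> complex) \<Rightarrow> nat \<Rightarrow> (nat \<Rightarrow> complex) \<Rightarrow> (nat \<Rightarrow> nat) \<Rightarrow> nat \<Rightarrow> nat \<Rightarrow> diff_op"
where
  "D_tilde L r m l k i =
     mult_op (cpow L ((\<Sum>j=1..i. m j) + of_nat i))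
     \<circ> ddx (lext r l k i - lext r l k (i + 1))
     \<circ> mult_op (cpow L (of_nat (lext r l k i) - of_nat (lext r l k (i + 1))
                          - (\<Sum>j=1..i. m j) - of_nat i))"

definition D_first ::
  "nat \<Rightarrow> (nat \<Rightarrow> complex) \<Rightarrow> nat \<Rightarrow> (nat \<Rightarrow> nat) \<Rightarrow> nat \<Rightarrow> diff_op"
where
  "D_first r m i l k = (\<lambda>f x.
     x * (x - 1) * deriv f x
     - (of_nat k + (\<Sum>s=1..i. m s) - of_nat (lext r l k i) + of_nat (lext r l k (i + 1))
          + of_nat i) * (x - 1) * f x
     - (of_nat k + 1) * f x)"

definition admissible :: "nat \<Rightarrow> (nat \<Rightarrow> nat) \<Rightarrow> nat \<Rightarrow> (nat \<Rightarrow> nat) \<Rightarrow> bool" where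
  "admissible r l k j \<longleftrightarrow>
     (\<forall>s\<in>{1..k}. j s \<le> r) \<and> (\<forall>t\<in>{1..r}. (\<Sum>s=1..k. one_vec (j s) t) = l t)"

text \<open>
  \<open>D_mlk r m j k\<close> is the operator \<open>D\<^bsub>m,l,k\<^esub>\<close> computed along the sequence \<open>j 1, \<dots>, j k\<close>, for
  \<open>l = 1\<^bsub>j 1\<^esub> + \<dots> + 1\<^bsub>j k\<^esub>\<close>, i.e. for \<open>admissible r l k j\<close>. Below, the factor with index \<open>s\<close> is
  \<open>D\<^bsub>j (s + 1)\<^esub>(1\<^bsub>j 1\<^esub> + \<dots> + 1\<^bsub>j s\<^esub>, s)\<close>.
\<close>

definition D_mlk :: "nat \<Rightarrow> (nat \<Rightarrow> complex) \<Rightarrow> (nat \<Rightarrow> nat) \<Rightarrow> nat \<Rightarrow> diff_op" where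
  "D_mlk r m j k =
     op_prod (\<lambda>s. D_first r m (j (s + 1)) (\<lambda>t. \<Sum>u=1..s. one_vec (j u) t) s) k"

definition omega ::
  "(complex \<Rightarrow> complex) \<Rightarrow> nat \<Rightarrow> (nat \<Rightarrow> complex) \<Rightarrow> nat \<Rightarrow> complex \<Rightarrow> complex"
where
  "omega L r m k x =
     (x - 1) powi (- int k - 1) * cpow L (- (\<Sum>i=1..r. m i) - of_nat r) x"

text \<open>Quantifying over admissible sequences is not vacuous:\<close>

lemma ex_admissible:
  assumes dec: "\<forall>i\<le>r. lext r l k (i + 1) \<le> lext r l k i"
  shows "\<exists>j. admissible r l k j"
proof -
  have mono: "lext r l k b \<le> lext r l k a" if "a \<le> b" "b \<le> r + 1" for a b
    using that
  proof (induction b rule: dec_induct)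
    case (step n)
    then show ?case using dec[rule_format, of n] by simp
  qed simp
  define j where "j s = card {i\<in>{1..r}. s \<le> l i}" for s
  have j_le: "j s \<le> r" for s
  proof -
    have "{i\<in>{1..r}. s \<le> l i} \<subseteq> {1..r}" by auto
    from card_mono[OF _ this] show ?thesis by (simp add: j_def)
  qed
  have one: "one_vec (j s) t = (if s \<le> l t then 1 else 0)" if t: "t \<in> {1..r}" for s t
  proof (cases "s \<le> l t")
    case True
    have "{1..t} \<subseteq> {i\<in>{1..r}. s \<le> l i}"
    proof
      fix i assume "i \<in> {1..t}"
      then show "i \<in> {i\<in>{1..r}. s \<le> l i}"
        using mono[of i t] t True by (auto simp: lext_def)
    qed
    from card_mono[OF _ this] have "t \<le> j s" by (simp add: j_def)
    then show ?thesis using True t by (simp add: one_vec_def)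
  next
    case False
    have "{i\<in>{1..r}. s \<le> l i} \<subseteq> {1..<t}"
    proof
      fix i assume i: "i \<in> {i\<in>{1..r}. s \<le> l i}"
      then have "\<not> t \<le> i"
        using mono[of t i] t False by (auto simp: lext_def)
      then show "i \<in> {1..<t}" using i by auto
    qed
    from card_mono[OF _ this] have "j s < t" using t by (auto simp: j_def)
    then show ?thesis using False by (simp add: one_vec_def)
  qed
  have "(\<Sum>s=1..k. one_vec (j s) t) = l t" if t: "t \<in> {1..r}" for t
  proof -
    have "l t \<le> k" using mono[of 0 t] t by (simp add: lext_def)
    then have eq: "{1..k} \<inter> {s. s \<le> l t} = {1..l t}" by auto
    have "(\<Sum>s=1..k. one_vec (j s) t) = (\<Sum>s=1..k. if s \<le> l t then 1 else 0)"
      using one[OF t] by simp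
    also have "\<dots> = l t"
      using eq by (simp add: sum.If_cases)
    finally show ?thesis .
  qed
  then have "admissible r l k j" using j_le by (simp add: admissible_def)
  then show ?thesis by blast
qed

end

theory Submission
  imports Defs
begin

text \<open>
  Everything is a polynomial in the Euler operator \<open>\<theta> = x d/dx\<close>. Write
  \<open>a\<^sub>i = m\<^sub>1 + \<dots> + m\<^sub>i + i\<close> (\<open>shift m i\<close> below) and
  \<open>n\<^sub>i = l\<^sub>i - l\<^bsub>i+1\<^esub>\<close>.

  On the one hand, \<open>d\<^sup>n x\<^sup>n = (\<theta> + 1) \<cdots> (\<theta> + n)\<close>, and conjugation by \<open>x\<^sup>a\<close> replaces \<open>\<theta>\<close> by
  \<open>\<theta> - a\<close>, so that the operator with a tilde is \<open>\<Prod>\<^bsub>p=1..n\<^sub>i\<^esub> (\<theta> + p - a\<^sub>i)\<close>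
  (lemma \<open>ddx_cpow\<close>). On the other hand, conjugation by powers of \<open>x - 1\<close> turns the first order
  operators into linear polynomials in \<open>\<theta>\<close> (lemma \<open>D_first_eq_euler\<close>):
  \<open>D\<^sub>i(l,k) (x - 1)\<^bsup>k+1\<^esup> = (x - 1)\<^bsup>k+2\<^esup> (\<theta> + n\<^sub>i + 1 - a\<^sub>i)\<close>.
  Along an admissible sequence, \<open>n\<^sub>i\<close> counts how often \<open>i\<close> has occurred so far: adding the vector
  \<open>1\<^sub>i\<close> to \<open>l\<close> and \<open>1\<close> to \<open>k\<close> raises \<open>n\<^sub>i\<close> by one and fixes all other \<open>n\<^bsub>i'\<^esub>\<close>. Hence the
  visits to \<open>i\<close> contribute the factors \<open>\<theta> + p - a\<^sub>i\<close> for \<open>p = 1, \<dots>, n\<^sub>i\<close>, each once, and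
  both operators equal \<open>(x - 1)\<^bsup>k+1\<^esup> \<Prod>\<^sub>i \<Prod>\<^sub>p (\<theta> + p - a\<^sub>i) (x - 1)\<^bsup>-1\<^esup>\<close>. The
  order of the visits is immaterial because polynomials in \<open>\<theta>\<close> commute.

  The second equality only merges the adjacent powers
  \<open>x\<^bsup>n\<^sub>i - a\<^sub>i\<^esup> x\<^bsup>a\<^bsub>i-1\<^esub>\<^esup> = x\<^bsup>n\<^sub>i - m\<^sub>i - 1\<^esup>\<close>.
\<close>

section \<open>Polynomials in the Euler operator\<close>

definition euler :: diff_op where
  "euler f = (\<lambda>x. x * deriv f x)"

text \<open>
  \<open>p(\<theta>) f\<close> by Horner's scheme, which suits induction over \<open>pCons\<close>: multiplication of a polynomial
  by its variable is then application of \<open>\<theta>\<close> on the outside, by definition.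
\<close>

definition theta_poly :: "complex poly \<Rightarrow> diff_op" where
  "theta_poly p f = fold_coeffs (\<lambda>a g x. a * f x + euler g x) p (\<lambda>_. 0)"

lemma theta_poly_0 [simp]: "theta_poly 0 f = (\<lambda>_. 0)"
  by (simp add: theta_poly_def)

lemma theta_poly_pCons: "theta_poly (pCons a p) f = (\<lambda>x. a * f x + euler (theta_poly p f) x)"
proof (cases "p = 0 \<and> a = 0")
  case True
  then show ?thesis by (simp add: euler_def)
next
  case False
  then show ?thesis
    by (cases "p = 0") (simp_all add: theta_poly_def)
qed

lemma theta_poly_1 [simp]: "theta_poly 1 f = f"
  by (simp add: one_pCons theta_poly_pCons euler_def)

lemma ddx_cong:
  assumes "open U" "\<And>x. x \<in> U \<Longrightarrow> f x = g x" "x \<in> U"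
  shows "ddx n f x = ddx n g x"
proof -
  have "eventually (\<lambda>y. f y = g y) (nhds x)"
    using assms by (auto simp: eventually_nhds)
  then show ?thesis unfolding ddx_def by (rule higher_deriv_cong_ev) simp
qed

lemma deriv_cong_open:
  fixes f g :: "complex \<Rightarrow> complex"
  assumes "open U" "\<And>x. x \<in> U \<Longrightarrow> f x = g x" "x \<in> U"
  shows "deriv f x = deriv g x"
proof -
  have "ddx 1 f x = ddx 1 g x" using assms by (rule ddx_cong)
  then show ?thesis by (simp add: ddx_def)
qed

lemma euler_cong:
  assumes "open U" "\<And>x. x \<in> U \<Longrightarrow> f x = g x" "x \<in> U"
  shows "euler f x = euler g x"
proof -
  have "deriv f x = deriv g x" using assms by (rule deriv_cong_open)
  then show ?thesis by (simp add: euler_def)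
qed

lemma theta_poly_cong:
  assumes "open U" "\<And>x. x \<in> U \<Longrightarrow> f x = g x" "x \<in> U"
  shows "theta_poly p f x = theta_poly p g x"
  using assms(3)
proof (induction p arbitrary: x)
  case (pCons a p)
  have "euler (theta_poly p f) x = euler (theta_poly p g) x"
    using assms(1) pCons.IH pCons.prems by (rule euler_cong)
  then show ?case
    using assms(2) pCons.prems by (simp add: theta_poly_pCons)
qed simp

lemma theta_poly_holomorphic:
  assumes "open U" "f holomorphic_on U"
  shows "theta_poly p f holomorphic_on U"
proof (induction p)
  case (pCons a p)
  then show ?case
    using assms unfolding theta_poly_pCons euler_def by (intro holomorphic_intros) auto
qed simp

lemma theta_poly_add:
  assumes U: "open U" and f: "f holomorphic_on U" and "x \<in> U"
  shows "theta_poly (p + q) f x = theta_poly p f x + theta_poly q f x"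
  using assms(3)
proof (induction p q arbitrary: x rule: poly_induct2)
  case (pCons a p b q)
  have diff: "theta_poly p' f field_differentiable at x" for p'
    using theta_poly_holomorphic[OF U f] U \<open>x \<in> U\<close>
    by (auto simp: holomorphic_on_open field_differentiable_def)
  have "euler (theta_poly (p + q) f) x = euler (\<lambda>x. theta_poly p f x + theta_poly q f x) x"
    using U pCons by (intro euler_cong)
  also have "\<dots> = euler (theta_poly p f) x + euler (theta_poly q f) x"
    by (simp add: euler_def deriv_add diff algebra_simps)
  finally show ?case by (simp add: theta_poly_pCons algebra_simps)
qed simp

lemma theta_poly_smult:
  assumes U: "open U" and f: "f holomorphic_on U" and "x \<in> U"
  shows "theta_poly (smult c p) f x = c * theta_poly p f x"
  using assms(3)
proof (induction p arbitrary: x)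
  case (pCons a p)
  have diff: "theta_poly p f field_differentiable at x"
    using theta_poly_holomorphic[OF U f] U \<open>x \<in> U\<close>
    by (auto simp: holomorphic_on_open field_differentiable_def)
  have "euler (theta_poly (smult c p) f) x = euler (\<lambda>x. c * theta_poly p f x) x"
    using U pCons by (intro euler_cong)
  also have "\<dots> = c * euler (theta_poly p f) x"
    by (simp add: euler_def deriv_cmult diff)
  finally show ?case by (simp add: theta_poly_pCons algebra_simps)
qed simp

text \<open>
  Through this lemma the commutativity of all the operators involved becomes the commutativity of
  polynomial multiplication.
\<close>

lemma theta_poly_mult:
  assumes U: "open U" and f: "f holomorphic_on U" and "x \<in> U"
  shows "theta_poly (p * q) f x = theta_poly p (theta_poly q f) x"
  using assms(3)
proof (induction p arbitrary: x)
  case (pCons a p)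
  have "theta_poly (pCons a p * q) f x = a * theta_poly q f x + euler (theta_poly (p * q) f) x"
    using assms(1,2) pCons.prems
    by (simp add: mult_pCons_left theta_poly_add theta_poly_smult theta_poly_pCons)
  also have "euler (theta_poly (p * q) f) x = euler (theta_poly p (theta_poly q f)) x"
    using U pCons by (intro euler_cong)
  finally show ?case by (simp add: theta_poly_pCons)
qed simp

lemma theta_poly_linear: "theta_poly [:c, 1:] f x = c * f x + x * deriv f x"
  by (simp add: theta_poly_pCons euler_def)

section \<open>The two kinds of factors as polynomials in the Euler operator\<close>

lemma cpow_add: "cpow L (a + b) x = cpow L a x * cpow L b x"
  by (simp add: cpow_def algebra_simps exp_add)

lemma cpow_0 [simp]: "cpow L 0 x = 1"
  by (simp add: cpow_def)

lemma cpow_add_one: "exp (L x) = x \<Longrightarrow> cpow L (a + 1) x = cpow L a x * x"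
  by (simp add: cpow_def algebra_simps exp_add)

lemma cpow_of_nat: "exp (L x) = x \<Longrightarrow> cpow L (of_nat n) x = x ^ n"
  by (simp add: cpow_def exp_of_nat_mult)

text \<open>
  Differentiating \<open>exp (L x) = x\<close> gives \<open>x * deriv L x = 1\<close>, so every branch of the power obeys the
  usual rule.
\<close>

lemma deriv_cpow:
  assumes "open U" "L holomorphic_on U" "\<forall>x\<in>U. exp (L x) = x" "x \<in> U"
  shows "(cpow L (a + 1) has_field_derivative (a + 1) * cpow L a x) (at x)"
proof -
  have L: "(L has_field_derivative deriv L x) (at x)"
    by (rule holomorphic_derivI[OF assms(2,1,4)])
  have ex: "exp (L x) = x" using assms by blast
  have "((\<lambda>x. exp (L x)) has_field_derivative exp (L x) * deriv L x) (at x)"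
    by (rule DERIV_fun_exp[OF L])
  moreover have "((\<lambda>x. exp (L x)) has_field_derivative 1) (at x)"
    by (rule has_field_derivative_transform_within_open[OF DERIV_ident assms(1,4)])
      (simp add: assms(3))
  ultimately have "exp (L x) * deriv L x = 1"
    by (rule DERIV_unique)
  then have inv: "x * deriv L x = 1"
    unfolding ex .
  have "(cpow L (a + 1) has_field_derivative cpow L (a + 1) x * ((a + 1) * deriv L x)) (at x)"
    unfolding cpow_def by (rule DERIV_fun_exp[OF DERIV_cmult[OF L]])
  moreover have "cpow L (a + 1) x * ((a + 1) * deriv L x) = (a + 1) * cpow L a x * (x * deriv L x)"
    unfolding cpow_add_one[of L x, OF ex] by (simp only: ac_simps)
  ultimately show ?thesis by (simp add: inv)
qed

text \<open>
  With \<open>\<theta>\<close> for the variable, this is \<open>(\<theta> - a + 1) \<cdots> (\<theta> - a + n)\<close>, the conjugate of \<open>d\<^sup>n x\<^sup>n\<close> by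
  \<open>x\<^sup>a\<close>.
\<close>

definition rising :: "nat \<Rightarrow> complex \<Rightarrow> complex poly" where
  "rising n a = (\<Prod>p=1..n. [:of_nat p - a, 1:])"

lemma rising_Suc: "rising (Suc n) a = [:of_nat n + 1 - a, 1:] * rising n a"
  by (simp add: rising_def add.commute mult.commute)

text \<open>
  Differentiating once gives \<open>d x\<^bsup>n+1-a\<^esup> = x\<^bsup>n-a\<^esup> (\<theta> + n + 1 - a)\<close>, and the other \<open>n\<close>
  derivatives are left to the induction hypothesis.
\<close>

lemma ddx_cpow:
  assumes U: "open U" and L: "L holomorphic_on U" "\<forall>x\<in>U. exp (L x) = x"
    and "g holomorphic_on U" "x \<in> U"
  shows "cpow L a x * ddx n (\<lambda>x. cpow L (of_nat n - a) x * g x) x = theta_poly (rising n a) g x"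
  using assms(4,5)
proof (induction n arbitrary: g x)
  case 0
  have "cpow L a x * cpow L (- a) x = 1"
    using cpow_add[of L a "-a" x] by simp
  then show ?case
    by (simp add: ddx_def rising_def flip: mult.assoc)
next
  case (Suc n)
  define c where "c = of_nat n + 1 - a"
  define h where "h = theta_poly [:c, 1:] g"
  have "deriv (\<lambda>x. cpow L (of_nat (Suc n) - a) x * g x) y = cpow L (of_nat n - a) y * h y"
    if "y \<in> U" for y
  proof -
    have p: "(cpow L (of_nat n - a + 1) has_field_derivative
               (of_nat n - a + 1) * cpow L (of_nat n - a) y) (at y)"
      by (rule deriv_cpow[OF U L that])
    have g: "(g has_field_derivative deriv g y) (at y)"
      using Suc.prems U that by (auto intro: holomorphic_derivI)
    have y: "cpow L (of_nat n - a + 1) y = cpow L (of_nat n - a) y * y"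
      using L that by (simp add: cpow_add_one)
    from DERIV_imp_deriv[OF DERIV_mult[OF p g]] show ?thesis
      unfolding h_def theta_poly_linear c_def y by (simp add: algebra_simps)
  qed
  then have "ddx n (deriv (\<lambda>x. cpow L (of_nat (Suc n) - a) x * g x)) x
           = ddx n (\<lambda>x. cpow L (of_nat n - a) x * h x) x"
    using U Suc.prems by (intro ddx_cong)
  then have "cpow L a x * ddx (Suc n) (\<lambda>x. cpow L (of_nat (Suc n) - a) x * g x) x
           = cpow L a x * ddx n (\<lambda>x. cpow L (of_nat n - a) x * h x) x"
    by (simp add: ddx_def funpow_Suc_right del: funpow.simps of_nat_Suc)
  also have "\<dots> = theta_poly (rising n a) h x"
    using Suc U by (auto intro!: Suc.IH theta_poly_holomorphic simp: h_def)
  also have "\<dots> = theta_poly (rising (Suc n) a) g x"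
    unfolding h_def rising_Suc c_def[symmetric]
    using U Suc.prems by (simp only: theta_poly_mult[symmetric] mult.commute)
  finally show ?case .
qed

definition shift :: "(nat \<Rightarrow> complex) \<Rightarrow> nat \<Rightarrow> complex" where
  "shift m i = (\<Sum>s=1..i. m s) + of_nat i"

lemma D_tilde_eq:
  assumes "lext r l k (i + 1) \<le> lext r l k i"
    and "open U" "L holomorphic_on U" "\<forall>x\<in>U. exp (L x) = x" "g holomorphic_on U" "x \<in> U"
  shows "D_tilde L r m l k i g x
    = theta_poly (rising (lext r l k i - lext r l k (i + 1)) (shift m i)) g x"
proof -
  have exps: "of_nat (lext r l k i) - of_nat (lext r l k (i + 1)) - (\<Sum>j=1..i. m j) - of_nat i
      = of_nat (lext r l k i - lext r l k (i + 1)) - shift m i"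
    using assms(1) by (simp add: shift_def of_nat_diff)
  then show ?thesis
    using ddx_cpow[OF assms(2-), of "shift m i"]
    unfolding D_tilde_def o_apply mult_op_def exps by (simp add: shift_def)
qed

text \<open>
  The terms of \<open>D_first\<close> that involve \<open>k\<close> cancel against the derivative of the power: differentiating
  \<open>(x - 1)\<^bsup>k+1\<^esup>\<close> in \<open>x (x - 1) d/dx\<close> produces the coefficient
  \<open>(k + 1) x = (k + 1)(x - 1) + (k + 1)\<close>.
\<close>

lemma D_first_eq_euler:
  assumes "open U" "g holomorphic_on U" "x \<in> U"
    and "lext r l k i = lext r l k (i + 1) + n"
  shows "D_first r m i l k (\<lambda>x. (x - 1) ^ (k + 1) * g x) x
    = (x - 1) ^ (k + 2) * theta_poly [:of_nat n + 1 - shift m i, 1:] g x"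
proof -
  have g: "(g has_field_derivative deriv g x) (at x)"
    using assms by (auto intro: holomorphic_derivI)
  have "((\<lambda>x. (x - 1) ^ (k + 1) * g x) has_field_derivative
          (of_nat k + 1) * (x - 1) ^ k * g x + (x - 1) ^ (k + 1) * deriv g x) (at x)"
    by (rule derivative_eq_intros g refl)+ (simp add: algebra_simps)
  note d = DERIV_imp_deriv[OF this]
  show ?thesis
    unfolding D_first_def d theta_poly_linear assms(4) shift_def
    by (simp add: algebra_simps)
qed

section \<open>Admissible sequences\<close>

text \<open>
  The vector \<open>1\<^bsub>j u\<^esub>\<close>, extended by \<open>1\<close> at \<open>0\<close> and \<open>0\<close> at \<open>r + 1\<close>, is \<open>1\<close> exactly at the
  indices \<open>t \<le> j u\<close>. So \<open>l\<^sub>t\<close> counts the \<open>u\<close> with \<open>t \<le> j u\<close>, also for \<open>t = 0\<close> and \<open>t = r + 1\<close>, and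
  \<open>n\<^sub>i = l\<^sub>i - l\<^bsub>i+1\<^esub>\<close> counts the visits to \<open>i\<close>.
\<close>

lemma lext_step:
  assumes "admissible r l k j" "i \<le> r"
  shows "lext r l k i = lext r l k (i + 1) + card {u\<in>{1..k}. j u = i}"
proof -
  have lext: "lext r l k t = card {u\<in>{1..k}. t \<le> j u}" if "t \<le> r + 1" for t
  proof -
    have "t = 0 \<or> t \<in> {1..r} \<or> t = r + 1" using that by auto
    then consider "t = 0" | "t \<in> {1..r}" | "t = r + 1" by blast
    then show ?thesis
    proof cases
      case 1
      then have "{u\<in>{1..k}. t \<le> j u} = {1..k}" by auto
      then show ?thesis using 1 by (simp add: lext_def)
    next
      case 2
      then have "l t = (\<Sum>s=1..k. one_vec (j s) t)"
        using assms by (simp add: admissible_def)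
      also have "\<dots> = (\<Sum>s=1..k. if t \<le> j s then 1 else 0)"
        using 2 by (simp add: one_vec_def)
      also have "\<dots> = card {u\<in>{1..k}. t \<le> j u}"
        by (simp add: sum.If_cases Int_def)
      finally show ?thesis using 2 by (simp add: lext_def)
    next
      case 3
      have "\<not> t \<le> j u" if "u \<in> {1..k}" for u
        using assms that 3 by (auto simp: admissible_def not_le intro: le_imp_less_Suc)
      then have "{u\<in>{1..k}. t \<le> j u} = {}"
        by blast
      then show ?thesis using 3 by (simp add: lext_def)
    qed
  qed
  have "{u\<in>{1..k}. i \<le> j u} = {u\<in>{1..k}. i + 1 \<le> j u} \<union> {u\<in>{1..k}. j u = i}"
    by auto
  then have "card {u\<in>{1..k}. i \<le> j u} = card {u\<in>{1..k}. i + 1 \<le> j u} + card {u\<in>{1..k}. j u = i}"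
    by (simp add: card_Un_disjoint disjoint_iff)
  then show ?thesis using lext[of i] lext[of "i + 1"] assms by simp
qed

text \<open>
  The polynomial after the first \<open>s\<close> steps, grouped by the visited index and not in the order of
  the visits. In this form a new visit changes a single factor.
\<close>

definition visit_poly :: "nat \<Rightarrow> (nat \<Rightarrow> complex) \<Rightarrow> (nat \<Rightarrow> nat) \<Rightarrow> nat \<Rightarrow> complex poly" where
  "visit_poly r m j s = (\<Prod>i<r+1. rising (card {u\<in>{1..s}. j u = i}) (shift m i))"

lemma visit_poly_Suc:
  assumes "j (Suc s) \<le> r"
  shows "visit_poly r m j (Suc s)
    = [:of_nat (card {u\<in>{1..s}. j u = j (Suc s)}) + 1 - shift m (j (Suc s)), 1:] * visit_poly r m j s"
proof -
  define i0 where "i0 = j (Suc s)"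
  have split: "{u\<in>{1..Suc s}. j u = i}
      = (if i = i0 then insert (Suc s) {u\<in>{1..s}. j u = i} else {u\<in>{1..s}. j u = i})" for i
    by (auto simp: i0_def le_Suc_eq)
  have "visit_poly r m j (Suc s)
      = rising (card {u\<in>{1..Suc s}. j u = i0}) (shift m i0)
        * (\<Prod>i\<in>{..<r+1} - {i0}. rising (card {u\<in>{1..Suc s}. j u = i}) (shift m i))"
    unfolding visit_poly_def using assms by (intro prod.remove) (auto simp: i0_def)
  also have "card {u\<in>{1..Suc s}. j u = i0} = Suc (card {u\<in>{1..s}. j u = i0})"
    unfolding split by simp
  also have "(\<Prod>i\<in>{..<r+1} - {i0}. rising (card {u\<in>{1..Suc s}. j u = i}) (shift m i))
      = (\<Prod>i\<in>{..<r+1} - {i0}. rising (card {u\<in>{1..s}. j u = i}) (shift m i))"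
    unfolding split by (intro prod.cong) auto
  finally show ?thesis
    unfolding rising_Suc mult.assoc visit_poly_def i0_def[symmetric]
    using assms by (subst prod.remove[of "{..<r+1}" i0]) (auto simp: i0_def)
qed

text \<open>
  Every prefix \<open>j 1, \<dots>, j s\<close> is admissible for its own sum \<open>1\<^bsub>j 1\<^esub> + \<dots> + 1\<^bsub>j s\<^esub>\<close>, so \<open>lext_step\<close>
  gives the constant in each first order factor. The power \<open>(x - 1)\<^bsup>s+1\<^esup>\<close> grows by one with each
  factor, which is exactly what \<open>D_first_eq_euler\<close> needs at the next step.
\<close>

lemma D_mlk_eq_visit_poly:
  assumes U: "open U" "1 \<notin> U" and f: "f holomorphic_on U"
    and "\<forall>u\<in>{1..s}. j u \<le> r" "x \<in> U"
  shows "D_mlk r m j s f x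
    = (x - 1) ^ (s + 1) * theta_poly (visit_poly r m j s) (\<lambda>x. f x / (x - 1)) x"
  using assms(4,5)
proof (induction s arbitrary: x)
  case 0
  then have "x \<noteq> 1" using U by auto
  then show ?case
    by (simp add: D_mlk_def visit_poly_def rising_def)
next
  case (Suc s)
  define h where "h = theta_poly (visit_poly r m j s) (\<lambda>x. f x / (x - 1))"
  define l where "l = (\<lambda>t. \<Sum>u=1..s. one_vec (j u) t)"
  define i where "i = j (s + 1)"
  have f1: "(\<lambda>x. f x / (x - 1)) holomorphic_on U"
    using f U by (intro holomorphic_intros) auto
  have h: "h holomorphic_on U"
    unfolding h_def using U f1 by (intro theta_poly_holomorphic)
  have "admissible r l s j"
    using Suc.prems by (simp add: admissible_def l_def)
  moreover have "i \<le> r" using Suc.prems by (simp add: i_def)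
  ultimately have step: "lext r l s i = lext r l s (i + 1) + card {u\<in>{1..s}. j u = i}"
    by (rule lext_step)
  have "D_mlk r m j s f y = (y - 1) ^ (s + 1) * h y" if "y \<in> U" for y
    using Suc.IH[OF _ that] Suc.prems by (simp add: h_def)
  then have "D_first r m i l s (D_mlk r m j s f) x
           = D_first r m i l s (\<lambda>x. (x - 1) ^ (s + 1) * h x) x"
    using deriv_cong_open[OF U(1), of "D_mlk r m j s f" "\<lambda>x. (x - 1) ^ (s + 1) * h x" x] Suc.prems
    by (simp add: D_first_def)
  also have "\<dots> = (x - 1) ^ (s + 2)
      * theta_poly [:of_nat (card {u\<in>{1..s}. j u = i}) + 1 - shift m i, 1:] h x"
    by (rule D_first_eq_euler[OF U(1) h Suc.prems(2) step])
  also have "theta_poly [:of_nat (card {u\<in>{1..s}. j u = i}) + 1 - shift m i, 1:] h x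
      = theta_poly (visit_poly r m j (Suc s)) (\<lambda>x. f x / (x - 1)) x"
  proof -
    have "visit_poly r m j (Suc s)
        = [:of_nat (card {u\<in>{1..s}. j u = i}) + 1 - shift m i, 1:] * visit_poly r m j s"
      using visit_poly_Suc[of j s r m] \<open>i \<le> r\<close> by (simp add: i_def del: mult_pCons_left)
    then show ?thesis
      by (simp only: h_def theta_poly_mult[OF U(1) f1 Suc.prems(2)])
  qed
  finally show ?case by (simp add: D_mlk_def i_def l_def)
qed

section \<open>Products of the operators with a tilde\<close>

lemma op_prod_D_tilde:
  assumes "\<forall>i<n. lext r l k (i + 1) \<le> lext r l k i"
    and U: "open U" and L: "L holomorphic_on U" "\<forall>x\<in>U. exp (L x) = x"
    and g: "g holomorphic_on U" and "x \<in> U"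
  shows "op_prod (D_tilde L r m l k) n g x
    = theta_poly (\<Prod>i<n. rising (lext r l k i - lext r l k (i + 1)) (shift m i)) g x"
  using assms(1,6)
proof (induction n arbitrary: x)
  case 0
  then show ?case by simp
next
  case (Suc n)
  define h where "h = theta_poly (\<Prod>i<n. rising (lext r l k i - lext r l k (i + 1)) (shift m i)) g"
  have h: "h holomorphic_on U"
    unfolding h_def using U g by (rule theta_poly_holomorphic)
  have eq: "op_prod (D_tilde L r m l k) n g y = h y" if "y \<in> U" for y
    using Suc that by (simp add: h_def)
  have "D_tilde L r m l k n (op_prod (D_tilde L r m l k) n g) x = D_tilde L r m l k n h x"
    using Suc.prems U eq
    by (auto simp: D_tilde_def mult_op_def intro!: ddx_cong[OF U])
  also have "\<dots> = theta_poly (rising (lext r l k n - lext r l k (n + 1)) (shift m n)) h x"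
    using Suc.prems U L h by (intro D_tilde_eq) auto
  finally show ?case
    using theta_poly_mult[OF U g Suc.prems(2)] by (simp add: h_def mult.commute)
qed

text \<open>
  The right factor \<open>x\<^bsup>n\<^sub>i - a\<^sub>i\<^esup>\<close> of one operator absorbs the left factor \<open>x\<^bsup>a\<^bsub>i-1\<^esub>\<^esup>\<close> of the previous
  one, and \<open>a\<^sub>i - a\<^bsub>i-1\<^esub> = m\<^sub>i + 1\<close>. These are identities of functions on \<open>U\<close>, which suffices under
  \<open>ddx\<close> since \<open>U\<close> is open.
\<close>

lemma op_prod_D_tilde_merge:
  assumes U: "open U" and L: "\<forall>x\<in>U. exp (L x) = x"
    and dec: "lext r l k 1 \<le> lext r l k 0" and "x \<in> U"
  shows "op_prod (D_tilde L r m l k) (n + 1) g x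
    = cpow L (shift m n) x
      * op_prod (\<lambda>i. ddx (lext r l k (i + 1) - lext r l k (i + 2))
                  \<circ> mult_op (cpow L (of_nat (lext r l k (i + 1))
                              - of_nat (lext r l k (i + 2)) - m (i + 1) - 1))) n
          (ddx (lext r l k 0 - lext r l k 1) (\<lambda>x. x ^ (lext r l k 0 - lext r l k 1) * g x)) x"
  using assms(4)
proof (induction n arbitrary: x)
  case 0
  have "cpow L (of_nat (lext r l k 0) - of_nat (lext r l k 1)) y = y ^ (lext r l k 0 - lext r l k 1)"
    if "y \<in> U" for y
    using cpow_of_nat[of L y "lext r l k 0 - lext r l k 1"] L that dec by (simp add: of_nat_diff)
  then show ?case
    using 0 by (auto simp: D_tilde_def mult_op_def shift_def intro!: ddx_cong[OF U])
next
  case (Suc n)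
  let ?B = "op_prod (\<lambda>i. ddx (lext r l k (i + 1) - lext r l k (i + 2))
                  \<circ> mult_op (cpow L (of_nat (lext r l k (i + 1))
                              - of_nat (lext r l k (i + 2)) - m (i + 1) - 1)))"
  define h where "h = ddx (lext r l k 0 - lext r l k 1) (\<lambda>x. x ^ (lext r l k 0 - lext r l k 1) * g x)"
  define e :: complex where "e = of_nat (lext r l k (n + 1)) - of_nat (lext r l k (n + 2))"
  have merge: "cpow L (e - shift m (n + 1)) y * op_prod (D_tilde L r m l k) (n + 1) g y
      = cpow L (e - m (n + 1) - 1) y * ?B n h y" if "y \<in> U" for y
  proof -
    have "e - m (n + 1) - 1 = (e - shift m (n + 1)) + shift m n"
      by (simp add: shift_def)
    then show ?thesis
      using Suc.IH[OF that] by (simp only: cpow_add h_def mult.assoc)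
  qed
  have exps: "of_nat (lext r l k (n + 1)) - of_nat (lext r l k (n + 1 + 1))
      - (\<Sum>j=1..n+1. m j) - of_nat (n + 1) = e - shift m (n + 1)"
    by (simp add: e_def shift_def)
  have "op_prod (D_tilde L r m l k) (Suc n + 1) g x
      = D_tilde L r m l k (n + 1) (op_prod (D_tilde L r m l k) (n + 1) g) x"
    by simp
  also have "\<dots> = cpow L (shift m (n + 1)) x * ddx (lext r l k (n + 1) - lext r l k (n + 2))
      (\<lambda>y. cpow L (e - shift m (n + 1)) y * op_prod (D_tilde L r m l k) (n + 1) g y) x"
    unfolding D_tilde_def exps by (simp add: mult_op_def shift_def)
  also have "ddx (lext r l k (n + 1) - lext r l k (n + 2))
      (\<lambda>y. cpow L (e - shift m (n + 1)) y * op_prod (D_tilde L r m l k) (n + 1) g y) x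
      = ddx (lext r l k (n + 1) - lext r l k (n + 2))
          (\<lambda>y. cpow L (e - m (n + 1) - 1) y * ?B n h y) x"
    using U merge Suc.prems by (intro ddx_cong)
  also have "\<dots> = ?B (Suc n) h x"
    by (simp add: mult_op_def e_def o_def)
  finally show ?case unfolding h_def Suc_eq_plus1 .
qed

lemma inverse_omega:
  "inverse (omega L r m k x) = (x - 1) ^ (k + 1) * cpow L (shift m r) x"
proof -
  have "- int k - 1 = - int (k + 1)" by simp
  then have "(x - 1) powi (- int k - 1) = inverse ((x - 1) ^ (k + 1))"
    by (simp only: power_int_minus power_int_of_nat)
  moreover have "- (\<Sum>i=1..r. m i) - of_nat r = - shift m r"
    by (simp add: shift_def)
  moreover have "inverse (cpow L (- shift m r) x) = cpow L (shift m r) x"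
    by (simp add: cpow_def exp_minus)
  ultimately show ?thesis
    by (simp add: omega_def)
qed

section \<open>Equality of the three expressions\<close>

theorem proposition4p2:
  fixes r k :: nat and l j :: "nat \<Rightarrow> nat" and m :: "nat \<Rightarrow> complex"
    and U :: "complex set" and L :: "complex \<Rightarrow> complex"
  assumes "\<forall>i\<le>r. lext r l k (i + 1) \<le> lext r l k i"
    and "admissible r l k j"
    and "open U" and "1 \<notin> U"
    and "L holomorphic_on U" and "\<forall>x\<in>U. exp (L x) = x"
  shows "op_eq_on U
           (D_mlk r m j k)
           (mult_op (\<lambda>x. (x - 1) ^ (k + 1)) \<circ> op_prod (D_tilde L r m l k) (r + 1)
              \<circ> mult_op (\<lambda>x. 1 / (x - 1)))
       \<and> op_eq_on U
           (mult_op (\<lambda>x. (x - 1) ^ (k + 1)) \<circ> op_prod (D_tilde L r m l k) (r + 1)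
              \<circ> mult_op (\<lambda>x. 1 / (x - 1)))
           (mult_op (\<lambda>x. inverse (omega L r m k x))
              \<circ> op_prod (\<lambda>i. ddx (lext r l k (i + 1) - lext r l k (i + 2))
                            \<circ> mult_op (cpow L (of_nat (lext r l k (i + 1))
                                        - of_nat (lext r l k (i + 2)) - m (i + 1) - 1))) r
              \<circ> ddx (lext r l k 0 - lext r l k 1)
              \<circ> mult_op (\<lambda>x. x ^ (lext r l k 0 - lext r l k 1) / (x - 1)))"
  (is "op_eq_on U ?A ?B \<and> op_eq_on U ?B ?C")
proof
  have visits: "card {u\<in>{1..k}. j u = i} = lext r l k i - lext r l k (i + 1)" if "i \<le> r" for i
    using lext_step[OF assms(2) that] by simp
  have poly: "visit_poly r m j k
      = (\<Prod>i<r+1. rising (lext r l k i - lext r l k (i + 1)) (shift m i))"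
    unfolding visit_poly_def by (intro prod.cong refl) (simp only: visits lessThan_iff less_Suc_eq_le Suc_eq_plus1[symmetric])
  show "op_eq_on U ?A ?B"
    unfolding op_eq_on_def
  proof (intro allI impI ballI)
    fix f x assume f: "f holomorphic_on U" and x: "x \<in> U"
    have f1: "(\<lambda>x. f x / (x - 1)) holomorphic_on U"
      using f assms(4) by (intro holomorphic_intros) auto
    have "?A f x = (x - 1) ^ (k + 1) * theta_poly (visit_poly r m j k) (\<lambda>x. f x / (x - 1)) x"
      using assms f x by (intro D_mlk_eq_visit_poly) (auto simp: admissible_def)
    also have "theta_poly (visit_poly r m j k) (\<lambda>x. f x / (x - 1)) x
        = op_prod (D_tilde L r m l k) (r + 1) (\<lambda>x. f x / (x - 1)) x"
      unfolding poly
      by (rule op_prod_D_tilde[OF _ assms(3,5,6) f1 x, symmetric]) (use assms(1) in auto)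
    finally show "?A f x = ?B f x"
      by (simp add: mult_op_def)
  qed
  show "op_eq_on U ?B ?C"
    unfolding op_eq_on_def
  proof (intro allI impI ballI)
    fix f x assume x: "x \<in> U"
    have dec: "lext r l k 1 \<le> lext r l k 0"
      using assms(1)[rule_format, of 0] by simp
    show "?B f x = ?C f x"
      using op_prod_D_tilde_merge[OF assms(3,6) dec x, of m r "\<lambda>x. 1 / (x - 1) * f x"]
      by (simp add: mult_op_def inverse_omega mult.assoc del: op_prod.simps)
  qed
qed

end
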